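(* The gradient system $\dot\theta=-\nabla L(\theta;J,\mu)$ is equivalent to the dynamics of an oscillator-based Ising machine.
   Context: The energy function is $$L(\theta;J,\mu)=-\sum_{1\le i<j\le n}J_{ij}\cos(\theta_i-\theta_j)+\frac{\mu}{2}\sum_{i=1}^n\sin^2\theta_i .$$ Here $\theta=(\theta_1,\dots,\theta_n)$ are angles (phases), $J=(J_{ij})$ with $J_{ij}=J_{ji}$ are the coupling constants of an undirected graph on $\{1,\dots,n\}$, $\mu$ is the penalty coefficient, and $\nabla L$ is the gradient with respect to $\theta$. The dynamics of an oscillator-based Ising machine is the system of ordinary differential equations $$\frac{d}{dt}\theta_i(t)=-K\sum_{j\ne i}J_{ij}\sin\big(\theta_i(t)-\theta_j(t)\big)-K_s\sin\big(2\theta_i(t)\big),\qquad i=1,\dots,n,$$ with constants $K$ and $K_s$. *)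

theory Defs
  imports "HOL-Analysis.Analysis"
begin

text \<open>
  The index set \<open>{1..n}\<close> is an arbitrary finite linearly ordered type \<open>'n\<close>; angles are
  represented by real numbers. The double sum runs over the ordered pairs \<open>i < j\<close>.
\<close>

definition energy ::
  "real ^ ('n::{finite,linorder}) ^ ('n::{finite,linorder}) \<Rightarrow> real \<Rightarrow> real ^ ('n::{finite,linorder}) \<Rightarrow> real" where
  "energy J \<mu> \<theta> =
     - (\<Sum>(i, j) \<in> {(i, j). i < j}. J $ i $ j * cos (\<theta> $ i - \<theta> $ j))
     + \<mu> / 2 * (\<Sum>i\<in>UNIV. (sin (\<theta> $ i))\<^sup>2)"

text \<open>
  Both notions of solution below are for curves on a time set \<open>T\<close>, meant to be an interval; at
  an endpoint belonging to \<open>T\<close> the derivative is one-sided. The gradient is given by the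
  library relation \<open>GDERIV\<close>, so a solution includes differentiability of \<open>F\<close> along the curve.
\<close>

definition gradient_solution ::
  "real set \<Rightarrow> ('a::real_inner \<Rightarrow> real) \<Rightarrow> (real \<Rightarrow> 'a) \<Rightarrow> bool" where
  "gradient_solution T F \<theta> \<longleftrightarrow>
     (\<forall>t\<in>T. \<exists>D. GDERIV F (\<theta> t) :> D \<and> (\<theta> has_vector_derivative - D) (at t within T))"

definition oim_solution ::
  "real set \<Rightarrow> real ^ 'n ^ 'n \<Rightarrow> real \<Rightarrow> real \<Rightarrow> (real \<Rightarrow> real ^ 'n) \<Rightarrow> bool" where
  "oim_solution T J K Ks \<theta> \<longleftrightarrow>
     (\<forall>t\<in>T. \<forall>i. ((\<lambda>s. \<theta> s $ i) has_real_derivative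
        - K * (\<Sum>j\<in>UNIV - {i}. J $ i $ j * sin (\<theta> t $ i - \<theta> t $ j))
        - Ks * sin (2 * \<theta> t $ i)) (at t within T))"

end

theory Submission
  imports Defs
begin

text \<open>
  Differentiating the energy in the coordinate \<open>\<theta>\<^sub>i\<close> leaves only the pairs that contain \<open>i\<close>. As
  \<open>J\<close> is symmetric and the cosine even, the order of a pair is immaterial to its energy, so the
  coupling part of the partial derivative is \<open>\<Sum>j\<noteq>i. J\<^sub>i\<^sub>j sin (\<theta>\<^sub>i - \<theta>\<^sub>j)\<close>, whether \<open>i\<close> is the
  smaller or the larger entry. The penalty part is
  \<open>\<mu> sin \<theta>\<^sub>i cos \<theta>\<^sub>i = (\<mu> / 2) sin (2 \<theta>\<^sub>i)\<close>. This is \<open>GDERIV_energy\<close>; the exchange of the two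
  orders of a pair is \<open>sum_pairs_antisym\<close>.

  Gradients are unique, so a gradient solution is a curve whose coordinates satisfy the ordinary
  differential equations with \<open>K = 1\<close> and \<open>K\<^sub>s = \<mu> / 2\<close>. For other constants there are two ways
  of absorbing \<open>K\<close>. Either it goes into the coupling matrix, as the gradient is linear in
  \<open>(J, \<mu>)\<close>, or, if \<open>K \<noteq> 0\<close>, it goes into the clock: running a solution at speed \<open>K\<close> multiplies
  its velocity by \<open>K\<close>, which turns the constants \<open>(1, K\<^sub>s / K)\<close> into \<open>(K, K\<^sub>s)\<close>.
\<close>

definition energy_gradient :: "real ^ 'n ^ 'n \<Rightarrow> real \<Rightarrow> real ^ 'n \<Rightarrow> real ^ 'n" where
  "energy_gradient J \<mu> \<theta> =
     (\<chi> i. (\<Sum>j\<in>UNIV - {i}. J $ i $ j * sin (\<theta> $ i - \<theta> $ j)) + \<mu> / 2 * sin (2 * \<theta> $ i))"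

text \<open>
  The term \<open>- a i j * h j\<close> of the pair \<open>i < j\<close> equals \<open>a j i * h j\<close>, the term that the pair
  \<open>(j, i)\<close> would contribute to the coefficient of its first entry. So the two halves of
  \<open>h i - h j\<close> account for the pairs on the two sides of the diagonal.
\<close>

lemma sum_pairs_antisym:
  fixes a :: "'n::{finite,linorder} \<Rightarrow> 'n \<Rightarrow> 'a::comm_ring" and h :: "'n \<Rightarrow> 'a"
  assumes antisym: "\<And>i j. a j i = - a i j"
  shows "(\<Sum>(i, j)\<in>{(i, j). i < j}. a i j * (h i - h j)) =
    (\<Sum>i\<in>UNIV. h i * (\<Sum>j\<in>UNIV - {i}. a i j))"
proof -
  let ?upper = "{(i, j). i < (j::'n)}" and ?lower = "{(i, j). j < (i::'n)}"
  have "(\<Sum>(i, j)\<in>?upper. a i j * (h i - h j)) =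
      (\<Sum>(i, j)\<in>?upper. h i * a i j) + (\<Sum>(i, j)\<in>?upper. h j * a j i)"
    unfolding sum.distrib[symmetric]
  proof (rule sum.cong[OF refl], clarify)
    fix i j
    show "a i j * (h i - h j) = h i * a i j + h j * a j i"
      by (simp add: antisym[of j i] algebra_simps)
  qed
  also have "(\<Sum>(i, j)\<in>?upper. h j * a j i) = (\<Sum>(i, j)\<in>?lower. h i * a i j)"
    by (rule sum.reindex_bij_witness[of _ prod.swap prod.swap]) auto
  also have "(\<Sum>(i, j)\<in>?upper. h i * a i j) + (\<Sum>(i, j)\<in>?lower. h i * a i j) =
      (\<Sum>(i, j)\<in>?upper \<union> ?lower. h i * a i j)"
    by (rule sum.union_disjoint[symmetric]) auto
  also have "?upper \<union> ?lower = (SIGMA i:UNIV. UNIV - {i})"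
    by auto
  also have "(\<Sum>(i, j)\<in>\<dots>. h i * a i j) = (\<Sum>i\<in>UNIV. \<Sum>j\<in>UNIV - {i}. h i * a i j)"
    by (rule sum.Sigma[symmetric]) auto
  finally show ?thesis
    by (simp add: sum_distrib_left)
qed

lemma GDERIV_energy:
  fixes J :: "real ^ ('n::{finite,linorder}) ^ ('n::{finite,linorder})"
  assumes sym: "\<And>i j. J $ i $ j = J $ j $ i"
  shows "GDERIV (energy J \<mu>) \<theta> :> energy_gradient J \<mu> \<theta>"
proof -
  let ?a = "\<lambda>i j. J $ i $ j * sin (\<theta> $ i - \<theta> $ j)"
  have antisym: "?a j i = - ?a i j" for i j
    using sym[of i j] sin_minus[of "\<theta> $ i - \<theta> $ j"] by simp
  have comp: "((\<lambda>x. x $ i) has_derivative (\<lambda>h. h $ i)) (at \<theta>)" for i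
    by (intro bounded_linear.has_derivative[OF bounded_linear_vec_nth] has_derivative_ident)
  have pair: "((\<lambda>x. case p of (i, j) \<Rightarrow> J $ i $ j * cos (x $ i - x $ j)) has_derivative
      (\<lambda>h. case p of (i, j) \<Rightarrow> - (?a i j * (h $ i - h $ j)))) (at \<theta>)" for p
    by (cases p) (auto intro!: derivative_eq_intros comp simp: algebra_simps)
  have pen: "((\<lambda>x. (sin (x $ i))\<^sup>2) has_derivative (\<lambda>h. h $ i * sin (2 * \<theta> $ i))) (at \<theta>)" for i
    unfolding sin_double by (auto intro!: derivative_eq_intros comp simp: algebra_simps)
  have "(energy J \<mu> has_derivative (\<lambda>h.
      - (\<Sum>(i, j)\<in>{(i, j). i < j}. - (?a i j * (h $ i - h $ j)))
      + \<mu> / 2 * (\<Sum>i\<in>UNIV. h $ i * sin (2 * \<theta> $ i)))) (at \<theta>)"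
    unfolding energy_def[abs_def]
    by (intro has_derivative_add has_derivative_minus has_derivative_mult_right
        has_derivative_sum pair pen)
  moreover have "- (\<Sum>(i, j)\<in>{(i, j). i < j}. - (?a i j * (h $ i - h $ j)))
      + \<mu> / 2 * (\<Sum>i\<in>UNIV. h $ i * sin (2 * \<theta> $ i)) = inner h (energy_gradient J \<mu> \<theta>)" for h
  proof -
    have "- (\<Sum>(i, j)\<in>{(i, j). i < j}. - (?a i j * (h $ i - h $ j))) =
        (\<Sum>(i, j)\<in>{(i, j). i < j}. ?a i j * (h $ i - h $ j))"
      by (simp add: sum_negf[symmetric] case_prod_unfold)
    also have "\<dots> = (\<Sum>i\<in>UNIV. h $ i * (\<Sum>j\<in>UNIV - {i}. ?a i j))"
      by (rule sum_pairs_antisym) (rule antisym)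
    finally show ?thesis
      by (simp add: inner_vec_def energy_gradient_def sum_distrib_left distrib_left
          sum.distrib mult.left_commute)
  qed
  ultimately show ?thesis
    by (simp add: gderiv_def)
qed

lemma GDERIV_unique:
  assumes "GDERIV F x :> D" and "GDERIV F x :> E"
  shows "D = E"
proof -
  have "(\<lambda>h. inner h D) = (\<lambda>h. inner h E)"
    using assms unfolding gderiv_def by (rule has_derivative_unique)
  then have "inner h D = inner h E" for h
    by (rule fun_cong)
  then show ?thesis
    using vector_eq_ldot by blast
qed

lemma gradient_solution_iff:
  assumes "\<And>x. GDERIV F x :> G x"
  shows "gradient_solution T F \<theta> \<longleftrightarrow>
    (\<forall>t\<in>T. (\<theta> has_vector_derivative - G (\<theta> t)) (at t within T))"
  unfolding gradient_solution_def using assms GDERIV_unique by metis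

lemma has_vector_derivative_vec_iff:
  fixes f :: "real \<Rightarrow> real ^ 'n"
  shows "(f has_vector_derivative D) (at t within T) \<longleftrightarrow>
    (\<forall>i. ((\<lambda>s. f s $ i) has_real_derivative D $ i) (at t within T))"
  unfolding has_vector_derivative_def has_field_derivative_def
  by (subst has_derivative_componentwise_within)
    (simp add: Basis_vec_def inner_axis mult_commute_abs)

lemma gradient_solution_energy_iff:
  fixes J :: "real ^ ('n::{finite,linorder}) ^ ('n::{finite,linorder})"
  assumes "\<And>i j. J $ i $ j = J $ j $ i"
  shows "gradient_solution T (energy J \<mu>) \<theta> \<longleftrightarrow> oim_solution T J 1 (\<mu> / 2) \<theta>"
  unfolding gradient_solution_iff[OF GDERIV_energy[OF assms]] oim_solution_def
    has_vector_derivative_vec_iff energy_gradient_def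
  by simp

lemma oim_solution_scaleR:
  "oim_solution T (c *\<^sub>R J) K Ks \<theta> \<longleftrightarrow> oim_solution T J (K * c) Ks \<theta>"
  by (simp add: oim_solution_def sum_distrib_left mult.assoc)

lemma oim_solution_time_scale:
  assumes "oim_solution ((*) c ` T) J K Ks \<theta>"
  shows "oim_solution T J (c * K) (c * Ks) (\<lambda>t. \<theta> (c * t))"
  unfolding oim_solution_def
proof (intro ballI allI)
  fix t i
  assume "t \<in> T"
  let ?v = "- K * (\<Sum>j\<in>UNIV - {i}. J $ i $ j * sin (\<theta> (c * t) $ i - \<theta> (c * t) $ j))
    - Ks * sin (2 * \<theta> (c * t) $ i)"
  have "((\<lambda>s. \<theta> s $ i) has_real_derivative ?v) (at (c * t) within (*) c ` T)"
    using assms \<open>t \<in> T\<close> unfolding oim_solution_def by blast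
  moreover have "((*) c has_real_derivative c) (at t within T)"
    by (auto intro!: derivative_eq_intros)
  ultimately have "((\<lambda>s. \<theta> s $ i) \<circ> (*) c has_real_derivative ?v * c) (at t within T)"
    by (rule DERIV_image_chain)
  then show "((\<lambda>s. \<theta> (c * s) $ i) has_real_derivative
      - (c * K) * (\<Sum>j\<in>UNIV - {i}. J $ i $ j * sin (\<theta> (c * t) $ i - \<theta> (c * t) $ j))
      - c * Ks * sin (2 * \<theta> (c * t) $ i)) (at t within T)"
    by (simp add: o_def algebra_simps)
qed

text \<open>For \<open>c \<noteq> 0\<close> the change of clock is undone by the factor \<open>1 / c\<close>.\<close>

lemma oim_solution_time_scale_iff:
  assumes "c \<noteq> 0"
  shows "oim_solution ((*) c ` T) J K Ks \<theta> \<longleftrightarrow>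
    oim_solution T J (c * K) (c * Ks) (\<lambda>t. \<theta> (c * t))" (is "?L \<longleftrightarrow> ?R")
proof
  show "?L \<Longrightarrow> ?R"
    by (rule oim_solution_time_scale)
  assume ?R
  moreover have "(*) (1 / c) ` (*) c ` T = T"
    using assms by (simp add: image_image)
  ultimately show ?L
    using oim_solution_time_scale[of "1 / c" "(*) c ` T" J "c * K" "c * Ks" "\<lambda>t. \<theta> (c * t)"] assms
    by simp
qed

theorem proposition3:
  fixes J :: "real ^ ('n::{finite,linorder}) ^ ('n::{finite,linorder})"
    and T :: "real set"
  assumes "\<forall>i j. J $ i $ j = J $ j $ i"
    and "is_interval T" and "interior T \<noteq> {}"
  shows
    "(\<forall>\<mu> \<theta>. gradient_solution T (energy J \<mu>) \<theta> \<longleftrightarrow> oim_solution T J 1 (\<mu> / 2) \<theta>) \<and>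
     (\<forall>K Ks \<theta>. gradient_solution T (energy (K *\<^sub>R J) (2 * Ks)) \<theta> \<longleftrightarrow> oim_solution T J K Ks \<theta>) \<and>
     (\<forall>K Ks \<mu> \<theta>. K \<noteq> 0 \<and> \<mu> = 2 * Ks / K \<longrightarrow>
        (gradient_solution ((\<lambda>t. K * t) ` T) (energy J \<mu>) \<theta> \<longleftrightarrow>
         oim_solution T J K Ks (\<lambda>t. \<theta> (K * t))))"
proof (intro conjI allI impI)
  have sym: "J $ i $ j = J $ j $ i" for i j
    using assms(1) by blast
  show "gradient_solution T (energy J \<mu>) \<theta> \<longleftrightarrow> oim_solution T J 1 (\<mu> / 2) \<theta>" for \<mu> \<theta>
    by (rule gradient_solution_energy_iff) (rule sym)
  show "gradient_solution T (energy (K *\<^sub>R J) (2 * Ks)) \<theta> \<longleftrightarrow> oim_solution T J K Ks \<theta>" for K Ks \<theta>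
    using gradient_solution_energy_iff[of "K *\<^sub>R J" T "2 * Ks" \<theta>] sym
    by (simp add: oim_solution_scaleR)
  show "gradient_solution ((\<lambda>t. K * t) ` T) (energy J \<mu>) \<theta> \<longleftrightarrow>
      oim_solution T J K Ks (\<lambda>t. \<theta> (K * t))" if "K \<noteq> 0 \<and> \<mu> = 2 * Ks / K" for K Ks \<mu> \<theta>
    using gradient_solution_energy_iff[OF sym, of "(*) K ` T" \<mu> \<theta>]
      oim_solution_time_scale_iff[of K T J 1 "\<mu> / 2" \<theta>] that
    by simp
qed

end
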